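(* Let $F(x)=Ax+\tilde f(x)$ be an analytic vector field in a neighbourhood of $0\in\mathbb{C}^n$, where $A$ is the Jacobian matrix of $F$ at $0$ and $\tilde f(x)=O(x^2)$, and let $\lambda_1,\dots,\lambda_n$ be the eigenvalues of $A$ (counted with multiplicity). If the system $\dot x=Ax+\tilde f(x)$ possesses an analytic tensor invariant of type $(p,q)$ of order $k$ in a neighbourhood of $x=0$, then there exist indices $i_1,\dots,i_p,j_1,\dots,j_q\in\{1,\dots,n\}$ and $k_1,\dots,k_n\in\mathbb{N}$ with $\sum_{j=1}^n k_j=k$ such that $$\sum_{j=1}^{n}k_{j}\lambda_{j}=\lambda_{i_{1}}+\cdots+\lambda_{i_{p}}-\lambda_{j_{1}}-\cdots-\lambda_{j_{q}}.$$
   Context: $\mathbb{N}=\{0,1,2,\dots\}$. Einstein summation is used. A tensor field of type $(p,q)$ is $T=T^{i_1\cdots i_p}_{j_1\cdots j_q}(x)\frac{\partial}{\partial x^{i_1}}\otimes\cdots\otimes\frac{\partial}{\partial x^{i_p}}\otimes dx^{j_1}\otimes\cdots\otimes dx^{j_q}$ with indices in $\{1,\dots,n\}$; it is analytic if all its components are analytic. The Lie derivative along $F=(F^1,\dots,F^n)$ is $$(L_FT)^{i_1\cdots i_p}_{j_1\cdots j_q}=F^s\frac{\partial}{\partial x^s}T^{i_1\cdots i_p}_{j_1\cdots j_q}+T^{i_1\cdots i_p}_{kj_2\cdots j_q}\frac{\partial F^k}{\partial x^{j_1}}+\cdots+T^{i_1\cdots i_p}_{j_1\cdots j_{q-1}k}\frac{\partial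 F^k}{\partial x^{j_q}}-T^{li_2\cdots i_p}_{j_1\cdots j_q}\frac{\partial F^{i_1}}{\partial x^l}-\cdots-T^{i_1\cdots i_{p-1}l}_{j_1\cdots j_q}\frac{\partial F^{i_p}}{\partial x^l}.$$ $T$ is a tensor invariant of $\dot x=F(x)$ if $L_FT=0$. An analytic tensor field $T$ near $0$ is of order $k$ if $T=T^{(k)}+T^{(k+1)}+\cdots$, where the components of each $T^{(r)}$ are homogeneous polynomials of degree $r$, and $T^{(k)}\not\equiv0$. *)

theory Defs
  imports
    "HOL-Analysis.Analysis"
    "HOL-Computational_Algebra.Polynomial"
    "HOL-Library.Landau_Symbols"
begin

section \<open>Analytic functions of several complex variables\<close>

text \<open>Multi-indices are functions \<open>'n \<Rightarrow> nat\<close>, with \<open>'n\<close> the finite index type of the coordinates.\<close>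

definition monomial :: "('n::finite \<Rightarrow> nat) \<Rightarrow> complex ^ 'n \<Rightarrow> complex" where
  "monomial \<alpha> x = (\<Prod>i\<in>UNIV. (x $ i) ^ \<alpha> i)"

text \<open>\<open>has_sum\<close> is unconditional, hence absolute, convergence of the multiple power series.\<close>

definition power_series_at :: "(complex ^ 'n::finite \<Rightarrow> complex) \<Rightarrow> complex ^ 'n \<Rightarrow> bool" where
  "power_series_at f a \<longleftrightarrow>
     (\<exists>r>0. \<exists>c. \<forall>x\<in>ball a r. ((\<lambda>\<alpha>. c \<alpha> * monomial \<alpha> (x - a)) has_sum f x) UNIV)"

definition analytic_fun_on :: "(complex ^ 'n::finite \<Rightarrow> complex) \<Rightarrow> (complex ^ 'n) set \<Rightarrow> bool" where
  "analytic_fun_on f U \<longleftrightarrow> (\<forall>a\<in>U. power_series_at f a)"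

definition analytic_field_on :: "(complex ^ 'n::finite \<Rightarrow> complex ^ 'n) \<Rightarrow> (complex ^ 'n) set \<Rightarrow> bool" where
  "analytic_field_on F U \<longleftrightarrow> (\<forall>i. analytic_fun_on (\<lambda>x. F x $ i) U)"

definition homogeneous_poly :: "nat \<Rightarrow> (complex ^ 'n::finite \<Rightarrow> complex) \<Rightarrow> bool" where
  "homogeneous_poly r g \<longleftrightarrow>
     (\<exists>c. \<forall>x. g x = (\<Sum>\<alpha> | (\<Sum>i\<in>UNIV. \<alpha> i) = r. c \<alpha> * monomial \<alpha> x))"

text \<open>\<open>axis s t\<close> is \<open>t\<close> times the \<open>s\<close>-th unit vector; \<open>deriv\<close> is the complex derivative.\<close>

definition cpartial :: "'n::finite \<Rightarrow> (complex ^ 'n \<Rightarrow> complex) \<Rightarrow> complex ^ 'n \<Rightarrow> complex" where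
  "cpartial s f x = deriv (\<lambda>t. f (x + axis s t)) 0"

definition cjacobian :: "(complex ^ 'n::finite \<Rightarrow> complex ^ 'n) \<Rightarrow> complex ^ 'n \<Rightarrow> complex ^ 'n ^ 'n" where
  "cjacobian F x = (\<chi> i j. cpartial j (\<lambda>y. F y $ i) x)"


section \<open>Eigenvalues with multiplicity\<close>

definition charpoly :: "complex ^ 'n ^ 'n::finite \<Rightarrow> complex poly" where
  "charpoly A = det (mat [:0, 1:] - (\<chi> i j. [:A $ i $ j:]))"

text \<open>The family \<open>(ev i)\<close>, indexed by the \<open>n\<close> elements of \<open>'n\<close>, lists the eigenvalues of
  \<open>A\<close>, each repeated according to its algebraic multiplicity.\<close>

definition eigenvalue_family :: "complex ^ 'n ^ 'n::finite \<Rightarrow> ('n \<Rightarrow> complex) \<Rightarrow> bool" where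
  "eigenvalue_family A ev \<longleftrightarrow> charpoly A = (\<Prod>i\<in>UNIV. [:- ev i, 1:])"


section \<open>Tensor fields\<close>

text \<open>A tensor field is given by its components: \<open>T I J x\<close> is the component with upper indices
  \<open>I = [i\<^sub>1, \<dots>, i\<^sub>p]\<close> and lower indices \<open>J = [j\<^sub>1, \<dots>, j\<^sub>q]\<close>. For a tensor field of type
  \<open>(p, q)\<close> only the values with \<open>length I = p\<close> and \<open>length J = q\<close> are meaningful; all notions
  below depend on these values only. Index tuples are lists so that \<open>p\<close> and \<open>q\<close> may be \<open>0\<close>.\<close>

type_synonym 'n tensor_field = "'n list \<Rightarrow> 'n list \<Rightarrow> complex ^ 'n \<Rightarrow> complex"

definition analytic_tensor_on ::
  "nat \<Rightarrow> nat \<Rightarrow> 'n::finite tensor_field \<Rightarrow> (complex ^ 'n) set \<Rightarrow> bool" where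
  "analytic_tensor_on p q T U \<longleftrightarrow>
     (\<forall>I J. length I = p \<longrightarrow> length J = q \<longrightarrow> analytic_fun_on (T I J) U)"

definition lie_derivative ::
  "(complex ^ 'n::finite \<Rightarrow> complex ^ 'n) \<Rightarrow> 'n tensor_field \<Rightarrow> 'n tensor_field" where
  "lie_derivative F T I J x =
     (\<Sum>s\<in>UNIV. F x $ s * cpartial s (T I J) x)
     + (\<Sum>m<length J. \<Sum>k\<in>UNIV. T I (J[m := k]) x * cpartial (J ! m) (\<lambda>y. F y $ k) x)
     - (\<Sum>m<length I. \<Sum>l\<in>UNIV. T (I[m := l]) J x * cpartial l (\<lambda>y. F y $ (I ! m)) x)"

definition tensor_invariant_on ::
  "nat \<Rightarrow> nat \<Rightarrow> (complex ^ 'n::finite \<Rightarrow> complex ^ 'n) \<Rightarrow> 'n tensor_field \<Rightarrow> (complex ^ 'n) set \<Rightarrow> bool" where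
  "tensor_invariant_on p q F T U \<longleftrightarrow>
     (\<forall>I J. length I = p \<longrightarrow> length J = q \<longrightarrow> (\<forall>x\<in>U. lie_derivative F T I J x = 0))"

definition tensor_order :: "nat \<Rightarrow> nat \<Rightarrow> 'n::finite tensor_field \<Rightarrow> nat \<Rightarrow> bool" where
  "tensor_order p q T k \<longleftrightarrow>
     (\<exists>H :: nat \<Rightarrow> 'n tensor_field.
        (\<forall>I J. length I = p \<longrightarrow> length J = q \<longrightarrow>
           (\<forall>r\<ge>k. homogeneous_poly r (H r I J)) \<and>
           (\<forall>\<^sub>F x in nhds 0. (\<lambda>r. H (k + r) I J x) sums T I J x)) \<and>
        (\<exists>I J x. length I = p \<and> length J = q \<and> H k I J x \<noteq> 0))"

end

theory Submission
  imports
    Defs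
    "HOL-Complex_Analysis.Complex_Analysis"
    "HOL-Computational_Algebra.Fundamental_Theorem_Algebra"
begin

text \<open>Only the lowest-order part \<open>P = T\<^sup>(\<^sup>k\<^sup>)\<close> of the invariant tensor matters. Dividing
  \<open>L\<^sub>F T = 0\<close> at the point \<open>t x\<close> by \<open>t\<^sup>k\<close> and letting \<open>t\<close> tend to \<open>0\<close> shows that \<open>P\<close>
  is annihilated by the Lie derivative along the linear field \<open>A x\<close>
  (\<open>lie_derivative_leading_term\<close>). The limit may be taken inside the partial derivatives because
  \<open>T(t y) / t\<^sup>k\<close> converges to \<open>P(y)\<close> uniformly for \<open>y\<close> in a ball (by Cauchy's estimates) and locally
  uniform limits of holomorphic functions commute with differentiation.

  The Lie derivative along a linear field commutes with the flat covariant derivative, which turns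
  a tensor of type \<open>(p, q)\<close> into one of type \<open>(p, q + 1)\<close>. Differentiating \<open>P\<close> exactly \<open>k\<close> times
  thus gives a constant invariant tensor of type \<open>(p, q + k)\<close>, and Euler's identity keeps it
  nonzero (\<open>homogeneous_invariant_tensor_eigenvalues\<close>).

  A constant tensor is a multilinear form, in which \<open>A\<close> acts on \<open>q + k\<close> slots and \<open>- A\<^sup>T\<close> on \<open>p\<close>
  slots, and invariance says that these actions sum to zero. For such a form, eigenvalues can be
  chosen slot by slot (\<open>multilinear_eigenvalue_sum\<close>): the vectors that make
  the form vanish when put into its first slot form a proper invariant subspace, so there is an eigenvector modulo that
  subspace; inserting it leaves a nonzero form in the remaining slots that satisfies the same
  equation, shifted by the eigenvalue. The eigenvalues obtained therefore sum to zero, and the \<open>k\<close>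
  slots that come from differentiation provide the exponents \<open>k\<^sub>1, \<dots>, k\<^sub>n\<close>.

  Multiplicities play no role: it suffices that every root of the characteristic polynomial occurs
  in the given family of eigenvalues.\<close>

(* The infix $ is to denote vector components only. *)
no_notation fps_nth (infixl "$" 75)


section \<open>Eigenvectors modulo an invariant subspace\<close>

text \<open>The vector \<open>p(B) x\<close>, computed by Horner's scheme.\<close>

definition poly_mat :: "complex ^ 'n ^ 'n::finite \<Rightarrow> complex poly \<Rightarrow> complex ^ 'n \<Rightarrow> complex ^ 'n" where
  "poly_mat B p x = fold_coeffs (\<lambda>a v. a *s x + B *v v) p 0"

lemma poly_mat_0 [simp]: "poly_mat B 0 x = 0"
  by (simp add: poly_mat_def)

lemma poly_mat_pCons [simp]: "poly_mat B (pCons a p) x = a *s x + B *v poly_mat B p x"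
proof (cases "p = 0 \<and> a = 0")
  case True
  then show ?thesis by simp
next
  case False
  then show ?thesis
    by (auto simp: poly_mat_def)
qed

lemma poly_mat_add: "poly_mat B (p + r) x = poly_mat B p x + poly_mat B r x"
  by (induction p r rule: poly_induct2)
     (simp_all add: matrix_vector_right_distrib vec.scale_left_distrib algebra_simps)

lemma poly_mat_smult: "poly_mat B (smult c p) x = c *s poly_mat B p x"
  by (induction p)
     (simp_all add: vec.scale_right_distrib vec.scale vector_smult_assoc)

lemma poly_mat_linear_factor:
  "poly_mat B ([:- \<mu>, 1:] * p) x = B *v poly_mat B p x - \<mu> *s poly_mat B p x"
proof -
  have "poly_mat B ([:- \<mu>, 1:] * p) x = poly_mat B (smult (- \<mu>) p + pCons 0 p) x"
    by simp
  then show ?thesis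
    unfolding poly_mat_add poly_mat_smult by (simp add: vec_eq_iff)
qed

lemma poly_mat_monom: "poly_mat B (monom 1 i) x = ((*v) B ^^ i) x"
  by (induction i) (simp_all add: monom_0 monom_Suc)

lemma exists_annihilating_poly:
  fixes B :: "complex ^ 'n ^ 'n::finite"
  obtains p where "p \<noteq> 0" "poly_mat B p x = 0"
proof -
  define W where "W i = (\<lambda>j. ((*v) B ^^ j) x) ` {..<i}" for i
  \<comment> \<open>The dimensions of the spans of \<open>x, B x, \<dots>, B\<^sup>i\<^sup>-\<^sup>1 x\<close> cannot grow forever.\<close>
  have "\<exists>i. ((*v) B ^^ i) x \<in> vec.span (W i)"
  proof (rule ccontr)
    assume *: "\<nexists>i. ((*v) B ^^ i) x \<in> vec.span (W i)"
    have W_Suc: "W (Suc i) = insert (((*v) B ^^ i) x) (W i)" for i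
      by (simp add: W_def lessThan_Suc)
    have "vec.dim (W i) = i" for i
    proof (induction i)
      case 0
      then show ?case by (simp add: W_def)
    next
      case (Suc i)
      then show ?case
        using * by (simp add: W_Suc vec.dim_insert del: funpow.simps)
    qed
    then show False
      by (metis Suc_n_not_le_n vec.dim_subset_UNIV)
  qed
  then obtain i where i: "((*v) B ^^ i) x \<in> vec.span (W i)" by blast
  have "vec.span (W i) \<subseteq> {poly_mat B r x |r. r = 0 \<or> degree r < i}"
  proof (rule vec.span_minimal)
    show "W i \<subseteq> {poly_mat B r x |r. r = 0 \<or> degree r < i}"
    proof
      fix w assume "w \<in> W i"
      then obtain j where "j < i" "w = poly_mat B (monom 1 j) x"
        by (auto simp: W_def poly_mat_monom)
      moreover have "degree (monom (1::complex) j) = j"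
        by (simp add: degree_monom_eq)
      ultimately show "w \<in> {poly_mat B r x |r. r = 0 \<or> degree r < i}"
        by auto
    qed
    show "vec.subspace {poly_mat B r x |r. r = 0 \<or> degree r < i}"
      unfolding vec.subspace_def
    proof (intro conjI ballI allI)
      show "0 \<in> {poly_mat B r x |r. r = 0 \<or> degree r < i}"
        by force
    next
      fix u v assume "u \<in> {poly_mat B r x |r. r = 0 \<or> degree r < i}"
        "v \<in> {poly_mat B r x |r. r = 0 \<or> degree r < i}"
      then obtain r s where "u = poly_mat B r x" "r = 0 \<or> degree r < i"
        "v = poly_mat B s x" "s = 0 \<or> degree s < i" by auto
      moreover from this have "r + s = 0 \<or> degree (r + s) < i"
        by (cases "r = 0"; cases "s = 0") (auto intro: degree_add_less)
      ultimately show "u + v \<in> {poly_mat B r x |r. r = 0 \<or> degree r < i}"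
        by (auto simp flip: poly_mat_add)
    next
      fix c u assume "u \<in> {poly_mat B r x |r. r = 0 \<or> degree r < i}"
      then obtain r where "u = poly_mat B r x" "r = 0 \<or> degree r < i" by auto
      moreover from this have "smult c r = 0 \<or> degree (smult c r) < i"
        by (metis degree_smult_le dual_order.strict_trans2 smult_0_right)
      ultimately show "c *s u \<in> {poly_mat B r x |r. r = 0 \<or> degree r < i}"
        by (auto simp flip: poly_mat_smult)
    qed
  qed
  with i obtain r where r: "((*v) B ^^ i) x = poly_mat B r x" "r = 0 \<or> degree r < i"
    by auto
  have "poly_mat B (monom 1 i + smult (-1) r) x = 0"
    unfolding poly_mat_add poly_mat_smult poly_mat_monom r(1) by (simp add: vec_eq_iff)
  moreover have "monom 1 i + smult (-1) r \<noteq> 0"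
  proof
    assume "monom 1 i + smult (-1) r = 0"
    then have "coeff (monom 1 i + smult (-1) r) i = 0" by simp
    with r(2) show False
      by (auto simp: coeff_eq_0)
  qed
  ultimately show ?thesis using that by blast
qed

text \<open>If \<open>\<mu> - B\<close> were invertible, it would map the finite-dimensional invariant subspace \<open>K\<close> onto
  itself and so could map no vector outside \<open>K\<close> into \<open>K\<close>.\<close>

lemma det_eq_0_if_eigenvector_mod_subspace:
  fixes B :: "complex ^ 'n ^ 'n::finite"
  assumes K: "vec.subspace K" and inv: "\<And>v. v \<in> K \<Longrightarrow> B *v v \<in> K"
    and y: "y \<notin> K" "B *v y - \<mu> *s y \<in> K"
  shows "det (mat \<mu> - B) = 0"
proof (rule ccontr)
  let ?M = "mat \<mu> - B"
  assume "det ?M \<noteq> 0"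
  then have "invertible ?M" by (simp add: invertible_det_nz)
  then have inj: "inj ((*v) ?M)"
    by (simp add: inj_matrix_vector_mult)
  have M: "?M *v v = \<mu> *s v - B *v v" for v
  proof -
    have "mat \<mu> *v v = \<mu> *s v"
      by (simp add: vec_eq_iff matrix_vector_mult_def mat_def if_distrib if_distribR cong: if_cong)
    then show ?thesis by (simp add: matrix_vector_mult_diff_rdistrib)
  qed
  have sub: "(*v) ?M ` K \<subseteq> K"
    using K inv by (auto simp: M intro!: vec.subspace_diff vec.subspace_scale)
  have lin: "Vector_Spaces.linear (*s) (*s) ((*v) ?M)"
    by (rule matrix_vector_mul_linear_gen)
  have "vec.dim ((*v) ?M ` K) = vec.dim K"
    by (rule vec.dim_image_eq[OF lin]) (use inj in \<open>auto intro: inj_on_subset\<close>)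
  then have eq: "(*v) ?M ` K = K"
    by (intro vec.subspace_dim_equal sub K vec.subspace_image) auto
  have "?M *v y = - (B *v y - \<mu> *s y)" by (simp add: M)
  then have "?M *v y \<in> K"
    using y(2) vec.subspace_neg[OF K] by metis
  then show False
    using eq inj y(1) by (metis image_iff inj_eq)
qed

lemma exists_eigenvector_mod_subspace:
  fixes B :: "complex ^ 'n ^ 'n::finite"
  assumes K: "vec.subspace K" and inv: "\<And>v. v \<in> K \<Longrightarrow> B *v v \<in> K" and x: "x \<notin> K"
  obtains y \<mu> where "y \<notin> K" "B *v y - \<mu> *s y \<in> K" "det (mat \<mu> - B) = 0"
proof -
  \<comment> \<open>In a polynomial \<open>r\<close> of least degree with \<open>r(B) x \<in> K\<close>, splitting off a linear factor leaves
    an \<open>s\<close> with \<open>s(B) x \<notin> K\<close>.\<close>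
  define P where "P r \<longleftrightarrow> r \<noteq> 0 \<and> poly_mat B r x \<in> K" for r
  have "\<exists>r. P r"
    using exists_annihilating_poly[of B x] vec.subspace_0[OF K] unfolding P_def by metis
  then obtain r where r: "P r" and min: "\<And>s. P s \<Longrightarrow> degree r \<le> degree s"
    using ex_has_least_nat[of P _ degree] by blast
  have "degree r \<noteq> 0"
  proof
    assume "degree r = 0"
    then obtain a where a: "r = [:a:]" by (rule degree_eq_zeroE)
    with r have "a \<noteq> 0" "a *s x \<in> K" by (auto simp: P_def)
    then have "inverse a *s (a *s x) \<in> K" using vec.subspace_scale[OF K] by metis
    moreover have "inverse a *s (a *s x) = x"
      using \<open>a \<noteq> 0\<close> by (simp add: vec_eq_iff)
    ultimately show False using x by metis
  qed
  then have "\<not> constant (poly r)" by (simp add: constant_degree)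
  then obtain \<mu> where "poly r \<mu> = 0" using fundamental_theorem_of_algebra by blast
  then obtain s where s: "r = [:- \<mu>, 1:] * s" by (metis dvdE poly_eq_0_iff_dvd)
  with r have "s \<noteq> 0" by (auto simp: P_def)
  then have "degree r = Suc (degree s)" unfolding s by (subst degree_mult_eq) simp_all
  then have "poly_mat B s x \<notin> K" using min[of s] \<open>s \<noteq> 0\<close> by (auto simp: P_def)
  moreover have "B *v poly_mat B s x - \<mu> *s poly_mat B s x \<in> K"
    using r unfolding P_def s poly_mat_linear_factor by blast
  ultimately show ?thesis
    using that det_eq_0_if_eigenvector_mod_subspace[OF K inv] by blast
qed


section \<open>Eigenvalues of multilinear forms\<close>

lemma poly_det: "poly (det M) z = det (\<chi> i j. poly (M $ i $ j) z)"
  for M :: "complex poly ^ 'n ^ 'n::finite"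
  by (simp add: det_def poly_sum poly_prod)

lemma poly_charpoly: "poly (charpoly A) \<mu> = det (mat \<mu> - A)"
proof -
  have "(\<chi> i j. poly ((mat [:0, 1:] - (\<chi> i j. [:A $ i $ j:])) $ i $ j) \<mu>) = mat \<mu> - A"
    by (simp add: vec_eq_iff mat_def)
  then show ?thesis unfolding charpoly_def poly_det by simp
qed

lemma eigenvalue_family_complete:
  assumes "eigenvalue_family A ev" "det (mat \<mu> - A) = 0"
  shows "\<exists>i. ev i = \<mu>"
  using assms by (auto simp: eigenvalue_family_def poly_prod simp flip: poly_charpoly)

lemma det_eq_0_uminus_transpose:
  fixes A :: "complex ^ 'n ^ 'n::finite"
  assumes "det (mat \<mu> - (- transpose A)) = 0"
  shows "det (mat (- \<mu>) - A) = 0"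
proof -
  have "mat (-1) ** M = - M" for M :: "complex ^ 'n ^ 'n"
    unfolding matrix_matrix_mult_def mat_def
    by (simp add: vec_eq_iff if_distrib if_distribR cong: if_cong)
  moreover have "transpose (mat \<mu> - (- transpose A)) = - (mat (- \<mu>) - A)"
    by (simp add: vec_eq_iff transpose_def mat_def)
  ultimately have "det (mat (-1) :: complex ^ 'n ^ 'n) * det (mat (- \<mu>) - A) = 0"
    using assms by (metis det_mul det_transpose)
  moreover have "det (mat (-1) :: complex ^ 'n ^ 'n) \<noteq> 0"
    by (subst det_diagonal) (simp_all add: mat_def)
  ultimately show ?thesis by simp
qed

text \<open>The function \<open>C\<close> gives the coefficients of a multilinear form on \<open>length Bs\<close> vectors. The
  hypothesis says that applying \<open>Bs ! m\<close> to the \<open>m\<close>-th vector and summing over \<open>m\<close> multiplies the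
  form by \<open>c\<close>.\<close>

lemma multilinear_eigenvalue_sum:
  fixes C :: "'n::finite list \<Rightarrow> complex"
  assumes "\<And>L. length L = length Bs \<Longrightarrow>
      (\<Sum>m<length Bs. \<Sum>l\<in>UNIV. C (L[m := l]) * (Bs ! m) $ l $ (L ! m)) = c * C L"
    and "length L0 = length Bs" "C L0 \<noteq> 0"
  shows "\<exists>\<mu>s. length \<mu>s = length Bs \<and> (\<forall>m<length Bs. det (mat (\<mu>s ! m) - Bs ! m) = 0) \<and>
    sum_list \<mu>s = c"
  using assms
proof (induction Bs arbitrary: C c L0)
  case Nil
  then show ?case by simp
next
  case (Cons B Bs)
  \<comment> \<open>\<open>D v\<close> is the form with \<open>v\<close> in its first slot, and \<open>S\<close> the action of \<open>Bs\<close> on the others.\<close>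
  define D where "D v L = (\<Sum>j\<in>UNIV. v $ j * C (j # L))" for v L
  define K where "K = {v. \<forall>L. length L = length Bs \<longrightarrow> D v L = 0}"
  define S where "S E L = (\<Sum>m<length Bs. \<Sum>l\<in>UNIV. E (L[m := l]) * (Bs ! m) $ l $ (L ! m))"
    for E and L :: "'n list"
  have D_add: "D (u + v) L = D u L + D v L" for u v L
    by (simp add: D_def algebra_simps sum.distrib)
  have D_scale: "D (a *s u) L = a * D u L" for u a L
    by (simp add: D_def algebra_simps sum_distrib_left)
  have D_diff: "D (u - v) L = D u L - D v L" for u v L
    by (simp add: D_def algebra_simps sum_subtractf)
  have slot: "(\<Sum>l\<in>UNIV. C (l # L) * B $ l $ j) + S (\<lambda>L. C (j # L)) L = c * C (j # L)"
    if "length L = length Bs" for j L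
    using Cons.prems(1)[of "j # L"] that
    by (simp add: S_def sum.lessThan_Suc_shift del: sum.lessThan_Suc)
  have contr: "D (B *v v) L + S (D v) L = c * D v L" if L: "length L = length Bs" for v L
  proof -
    have "D (B *v v) L = (\<Sum>l\<in>UNIV. \<Sum>j\<in>UNIV. v $ j * (C (l # L) * B $ l $ j))"
      by (simp add: D_def matrix_vector_mult_def sum_distrib_left mult_ac)
    also have "\<dots> = (\<Sum>j\<in>UNIV. v $ j * (\<Sum>l\<in>UNIV. C (l # L) * B $ l $ j))"
      by (subst sum.swap) (simp add: sum_distrib_left)
    finally have 1: "D (B *v v) L = \<dots>" .
    have "S (D v) L = (\<Sum>m<length Bs. \<Sum>l\<in>UNIV. \<Sum>j\<in>UNIV.
        v $ j * (C (j # L[m := l]) * (Bs ! m) $ l $ (L ! m)))"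
      by (simp add: S_def D_def sum_distrib_left mult_ac)
    also have "\<dots> = (\<Sum>m<length Bs. \<Sum>j\<in>UNIV. \<Sum>l\<in>UNIV.
        v $ j * (C (j # L[m := l]) * (Bs ! m) $ l $ (L ! m)))"
      by (intro sum.cong refl sum.swap)
    also have "\<dots> = (\<Sum>j\<in>UNIV. v $ j * S (\<lambda>L. C (j # L)) L)"
      by (subst sum.swap) (simp add: S_def sum_distrib_left)
    finally have 2: "S (D v) L = \<dots>" .
    have "D (B *v v) L + S (D v) L
        = (\<Sum>j\<in>UNIV. v $ j * ((\<Sum>l\<in>UNIV. C (l # L) * B $ l $ j) + S (\<lambda>L. C (j # L)) L))"
      unfolding 1 2 by (simp add: sum.distrib distrib_left)
    also have "\<dots> = c * D v L"
      unfolding slot[OF L] by (simp add: D_def sum_distrib_left mult_ac)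
    finally show ?thesis .
  qed
  have S_0: "S (D v) L = 0" if "v \<in> K" "length L = length Bs" for v L
    using that by (simp add: S_def K_def)
  have K: "vec.subspace K"
    by (auto simp: vec.subspace_def K_def D_add D_scale) (simp add: D_def)
  have inv: "B *v v \<in> K" if "v \<in> K" for v
  proof -
    have "D (B *v v) L = 0" if L: "length L = length Bs" for L
      using contr[OF L, of v] S_0[OF \<open>v \<in> K\<close> L] \<open>v \<in> K\<close> L by (simp add: K_def)
    then show ?thesis by (simp add: K_def)
  qed
  obtain j0 L1 where L1: "L0 = j0 # L1" "length L1 = length Bs"
    using Cons.prems(2) by (cases L0) auto
  have "D (axis j0 1) L1 = C L0"
    by (simp add: D_def axis_def L1 if_distrib if_distribR cong: if_cong)
  then have "axis j0 1 \<notin> K" using Cons.prems(3) L1 by (auto simp: K_def)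
  then obtain y \<mu> where y: "y \<notin> K" "B *v y - \<mu> *s y \<in> K" "det (mat \<mu> - B) = 0"
    using exists_eigenvector_mod_subspace[OF K inv] by blast
  then obtain L2 where L2: "length L2 = length Bs" "D y L2 \<noteq> 0" by (auto simp: K_def)
  have "S (D y) L = (c - \<mu>) * D y L" if L: "length L = length Bs" for L
  proof -
    have "D (B *v y) L = \<mu> * D y L"
      using y(2) L by (simp add: K_def D_diff D_scale)
    then show ?thesis using contr[OF L, of y] by (simp add: algebra_simps)
  qed
  then obtain \<mu>s where \<mu>s: "length \<mu>s = length Bs" "sum_list \<mu>s = c - \<mu>"
    "\<forall>m<length Bs. det (mat (\<mu>s ! m) - Bs ! m) = 0"
    using Cons.IH[of "D y" "c - \<mu>" L2] L2 unfolding S_def by blast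
  show ?case
    by (rule exI[of _ "\<mu> # \<mu>s"]) (use \<mu>s y(3) in \<open>auto simp: nth_Cons split: nat.split\<close>)
qed


section \<open>Partial derivatives of homogeneous polynomials\<close>

text \<open>The partial derivative of \<open>g\<close> in direction \<open>s\<close> at \<open>x\<close> exists and equals \<open>d\<close>.\<close>

abbreviation has_cpartial :: "'n::finite \<Rightarrow> (complex ^ 'n \<Rightarrow> complex) \<Rightarrow> complex ^ 'n \<Rightarrow> complex \<Rightarrow> bool" where
  "has_cpartial s g x d \<equiv> ((\<lambda>t. g (x + axis s t)) has_field_derivative d) (at 0)"

lemma cpartial_eqI: "has_cpartial s g x d \<Longrightarrow> cpartial s g x = d"
  by (simp add: cpartial_def DERIV_imp_deriv)

lemma has_cpartial_add:
  "has_cpartial s g x d \<Longrightarrow> has_cpartial s h x e \<Longrightarrow> has_cpartial s (\<lambda>x. g x + h x) x (d + e)"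
  by (rule DERIV_add)

lemma has_cpartial_monomial:
  "has_cpartial s (\<lambda>x. c * monomial \<alpha> x) x (c * (of_nat (\<alpha> s) * monomial (\<alpha>(s := \<alpha> s - 1)) x))"
proof -
  define R where "R = (\<Prod>i\<in>UNIV - {s}. (x $ i) ^ \<alpha> i)"
  have split: "monomial \<beta> y = (y $ s) ^ \<beta> s * (\<Prod>i\<in>UNIV - {s}. (y $ i) ^ \<beta> i)" for \<beta> y
    unfolding monomial_def by (rule prod.remove) auto
  have "monomial \<alpha> (x + axis s t) = (x $ s + t) ^ \<alpha> s * R" for t
    unfolding split R_def by (intro arg_cong2[where f = "(*)"] prod.cong) (auto simp: axis_def)
  moreover have "monomial (\<alpha>(s := \<alpha> s - 1)) x = (x $ s) ^ (\<alpha> s - 1) * R"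
    unfolding split R_def by (intro arg_cong2[where f = "(*)"] prod.cong) auto
  ultimately show ?thesis
    by (auto intro!: derivative_eq_intros)
qed

lemmas cpartial_monomial = has_cpartial_monomial[THEN cpartial_eqI]

lemma finite_multi_indices: "finite {\<alpha> :: 'n::finite \<Rightarrow> nat. (\<Sum>i\<in>UNIV. \<alpha> i) = r}"
proof (rule finite_subset)
  show "{\<alpha> :: 'n \<Rightarrow> nat. (\<Sum>i\<in>UNIV. \<alpha> i) = r} \<subseteq> PiE UNIV (\<lambda>_. {..r})"
    by (auto intro!: member_le_sum)
qed (auto intro!: finite_PiE)

lemma homogeneous_poly_monomial:
  assumes "(\<Sum>i\<in>UNIV. \<alpha> i) = r"
  shows "homogeneous_poly r (\<lambda>x. c * monomial \<alpha> x)"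
  unfolding homogeneous_poly_def
proof (intro exI allI)
  fix x :: "complex ^ 'a"
  have "(\<Sum>\<beta> | (\<Sum>i\<in>UNIV. \<beta> i) = r. (if \<beta> = \<alpha> then c else 0) * monomial \<beta> x)
      = (\<Sum>\<beta> | (\<Sum>i\<in>UNIV. \<beta> i) = r. if \<beta> = \<alpha> then c * monomial \<alpha> x else 0)"
    by (intro sum.cong) auto
  then show "c * monomial \<alpha> x
      = (\<Sum>\<beta> | (\<Sum>i\<in>UNIV. \<beta> i) = r. (if \<beta> = \<alpha> then c else 0) * monomial \<beta> x)"
    using assms by (simp add: finite_multi_indices)
qed

lemma homogeneous_poly_add:
  assumes "homogeneous_poly r g" "homogeneous_poly r h"
  shows "homogeneous_poly r (\<lambda>x. g x + h x)"
proof -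
  obtain c d where "\<And>x. g x = (\<Sum>\<alpha> | (\<Sum>i\<in>UNIV. \<alpha> i) = r. c \<alpha> * monomial \<alpha> x)"
    "\<And>x. h x = (\<Sum>\<alpha> | (\<Sum>i\<in>UNIV. \<alpha> i) = r. d \<alpha> * monomial \<alpha> x)"
    using assms by (auto simp: homogeneous_poly_def)
  then have "g x + h x = (\<Sum>\<alpha> | (\<Sum>i\<in>UNIV. \<alpha> i) = r. (c \<alpha> + d \<alpha>) * monomial \<alpha> x)" for x
    by (simp add: sum.distrib distrib_right)
  then show ?thesis unfolding homogeneous_poly_def by (intro exI[of _ "\<lambda>\<alpha>. c \<alpha> + d \<alpha>"]) auto
qed

lemma homogeneous_poly_zero: "homogeneous_poly r (\<lambda>x. 0)"
  unfolding homogeneous_poly_def by (intro exI[of _ "\<lambda>_. 0"]) auto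

lemma homogeneous_poly_induct [consumes 1, case_names zero monomial add]:
  assumes g: "homogeneous_poly r g"
    and zero: "P (\<lambda>x. 0)"
    and monomial: "\<And>c \<alpha>. (\<Sum>i\<in>UNIV. \<alpha> i) = r \<Longrightarrow> P (\<lambda>x. c * monomial \<alpha> x)"
    and add: "\<And>g h. homogeneous_poly r g \<Longrightarrow> homogeneous_poly r h \<Longrightarrow> P g \<Longrightarrow> P h \<Longrightarrow>
      P (\<lambda>x. g x + h x)"
  shows "P g"
proof -
  obtain c where c: "g = (\<lambda>x. \<Sum>\<alpha> | (\<Sum>i\<in>UNIV. \<alpha> i) = r. c \<alpha> * monomial \<alpha> x)"
    using g by (auto simp: homogeneous_poly_def fun_eq_iff)
  have "homogeneous_poly r (\<lambda>x. \<Sum>\<alpha>\<in>S. c \<alpha> * monomial \<alpha> x) \<and>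
      P (\<lambda>x. \<Sum>\<alpha>\<in>S. c \<alpha> * monomial \<alpha> x)"
    if "finite S" "S \<subseteq> {\<alpha>. (\<Sum>i\<in>UNIV. \<alpha> i) = r}" for S
    using that
  proof (induction S)
    case empty
    then show ?case using zero homogeneous_poly_zero by simp
  next
    case (insert \<alpha> S)
    then show ?case
      using add[OF homogeneous_poly_monomial, of \<alpha>] monomial[of \<alpha>]
        homogeneous_poly_add[OF homogeneous_poly_monomial, of \<alpha> r] by simp
  qed
  from this[OF finite_multi_indices subset_refl] show ?thesis unfolding c by blast
qed

lemma homogeneous_poly_has_cpartial:
  assumes "homogeneous_poly r g"
  shows "has_cpartial s g x (cpartial s g x)"
  using assms
proof (induction rule: homogeneous_poly_induct)
  case zero
  then show ?case by (simp add: cpartial_def)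
next
  case (monomial c \<alpha>)
  then show ?case using has_cpartial_monomial by (simp add: cpartial_monomial)
next
  case (add g h)
  have "has_cpartial s (\<lambda>x. g x + h x) x (cpartial s g x + cpartial s h x)"
    by (rule has_cpartial_add[OF add.IH])
  then show ?case by (simp only: cpartial_eqI)
qed

lemma cpartial_add:
  assumes "homogeneous_poly r g" "homogeneous_poly r h"
  shows "cpartial s (\<lambda>x. g x + h x) = (\<lambda>x. cpartial s g x + cpartial s h x)"
  by (intro ext cpartial_eqI has_cpartial_add homogeneous_poly_has_cpartial[OF assms(1)]
      homogeneous_poly_has_cpartial[OF assms(2)])

lemma cpartial_const: "cpartial s (\<lambda>x. c) = (\<lambda>x. 0)"
  by (simp add: cpartial_def fun_eq_iff)

lemmas cpartial_zero = cpartial_const[of _ 0]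

text \<open>For \<open>r = 0\<close> the partial derivatives vanish, so the truncated difference does no harm.\<close>

lemma homogeneous_poly_cpartial:
  assumes "homogeneous_poly r g"
  shows "homogeneous_poly (r - 1) (cpartial s g)"
  using assms
proof (induction rule: homogeneous_poly_induct)
  case zero
  then show ?case by (simp add: cpartial_zero homogeneous_poly_zero)
next
  case (monomial c \<alpha>)
  have eq: "cpartial s (\<lambda>x. c * monomial \<alpha> x)
      = (\<lambda>x. (c * of_nat (\<alpha> s)) * monomial (\<alpha>(s := \<alpha> s - 1)) x)"
    by (simp add: cpartial_monomial fun_eq_iff)
  show ?case
  proof (cases "\<alpha> s = 0")
    case True
    then show ?thesis by (simp add: eq homogeneous_poly_zero)
  next
    case False
    have "(\<Sum>i\<in>UNIV. (\<alpha>(s := \<alpha> s - 1)) i) = (\<alpha> s - 1) + (\<Sum>i\<in>UNIV - {s}. \<alpha> i)"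
      by (subst sum.remove[of _ s]) auto
    moreover have "(\<Sum>i\<in>UNIV. \<alpha> i) = \<alpha> s + (\<Sum>i\<in>UNIV - {s}. \<alpha> i)"
      by (subst sum.remove[of _ s]) auto
    ultimately show ?thesis
      unfolding eq using monomial False by (intro homogeneous_poly_monomial) auto
  qed
next
  case (add g h)
  then show ?case by (simp add: cpartial_add[OF add.hyps] homogeneous_poly_add)
qed

lemma cpartial_commute:
  assumes "homogeneous_poly r g"
  shows "cpartial s (cpartial u g) = cpartial u (cpartial s g)"
  using assms
proof (induction rule: homogeneous_poly_induct)
  case zero
  then show ?case by (simp add: cpartial_zero)
next
  case (monomial c \<alpha>)
  have eq: "cpartial s (\<lambda>x. c * monomial \<alpha> x)
      = (\<lambda>x. (c * of_nat (\<alpha> s)) * monomial (\<alpha>(s := \<alpha> s - 1)) x)" for s c and \<alpha> :: "'a \<Rightarrow> nat"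
    by (simp add: cpartial_monomial fun_eq_iff)
  show ?case
  proof (cases "s = u")
    case False
    then show ?thesis unfolding eq by (simp add: fun_upd_twist[of s u] mult_ac)
  qed simp
next
  case (add g h)
  show ?case
    unfolding cpartial_add[OF add.hyps]
    by (simp add: cpartial_add[OF add.hyps[THEN homogeneous_poly_cpartial]] add.IH)
qed

lemma euler_homogeneous:
  assumes "homogeneous_poly r g"
  shows "(\<Sum>s\<in>UNIV. x $ s * cpartial s g x) = of_nat r * g x"
  using assms
proof (induction rule: homogeneous_poly_induct)
  case zero
  then show ?case by (simp add: cpartial_zero)
next
  case (monomial c \<alpha>)
  have "x $ s * cpartial s (\<lambda>x. c * monomial \<alpha> x) x = of_nat (\<alpha> s) * (c * monomial \<alpha> x)" for s
  proof -
    have "x $ s * monomial (\<alpha>(s := \<alpha> s - 1)) x = monomial \<alpha> x" if "\<alpha> s \<noteq> 0"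
    proof -
      have split: "monomial \<beta> x = (x $ s) ^ \<beta> s * (\<Prod>i\<in>UNIV - {s}. (x $ i) ^ \<beta> i)" for \<beta>
        unfolding monomial_def by (rule prod.remove) auto
      show ?thesis
        unfolding split using that by (simp add: power_eq_if)
    qed
    then show ?thesis by (cases "\<alpha> s = 0") (auto simp: cpartial_monomial mult_ac)
  qed
  then show ?case using monomial by (simp flip: sum_distrib_right of_nat_sum)
next
  case (add g h)
  then show ?case
    by (simp add: cpartial_add[OF add.hyps] sum.distrib distrib_left)
qed

lemma homogeneous_poly_0_const:
  assumes "homogeneous_poly 0 g"
  shows "g x = g 0"
  using assms
  by (induction rule: homogeneous_poly_induct) (simp_all add: monomial_def)

lemma homogeneous_poly_scale:
  assumes "homogeneous_poly r g"
  shows "g (t *s x) = t ^ r * g x"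
  using assms
proof (induction rule: homogeneous_poly_induct)
  case (monomial c \<alpha>)
  then show ?case
    by (auto simp: monomial_def power_mult_distrib prod.distrib power_sum)
qed (simp_all add: distrib_left)


section \<open>Homogeneous tensors invariant under a linear field\<close>

lemma has_cpartial_matrix_mult:
  "has_cpartial s (\<lambda>y. (A *v y) $ i) x (A $ i $ s)"
proof -
  have "(A *v (x + axis s t)) $ i = (A *v x) $ i + A $ i $ s * t" for t
    by (simp add: matrix_vector_right_distrib)
       (simp add: matrix_vector_mult_def axis_def if_distrib if_distribR cong: if_cong)
  then show ?thesis by (auto intro!: derivative_eq_intros)
qed

lemmas cpartial_matrix_mult = has_cpartial_matrix_mult[THEN cpartial_eqI]

text \<open>The flat covariant derivative; the new lower index, that of the differentiation, comes
  first.\<close>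

definition gradient_tensor :: "'n::finite tensor_field \<Rightarrow> 'n tensor_field" where
  "gradient_tensor T I J = cpartial (hd J) (T I (tl J))"

text \<open>The Lie derivative along a linear field commutes with the covariant derivative: the term of
  the new index \<open>r\<close> is the one that arises when \<open>A x\<close> itself is differentiated.\<close>

lemma lie_derivative_gradient:
  fixes T :: "'n::finite tensor_field"
  assumes hom: "\<And>I' J'. length I' = length I \<Longrightarrow> length J' = length J \<Longrightarrow> homogeneous_poly k (T I' J')"
  shows "has_cpartial r (lie_derivative (\<lambda>x. A *v x) T I J) x
      (lie_derivative (\<lambda>x. A *v x) (gradient_tensor T) I (r # J) x)"
proof -
  let ?D = "(\<Sum>s\<in>UNIV. A $ s $ r * cpartial s (T I J) x
        + (A *v x) $ s * cpartial r (cpartial s (T I J)) x)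
     + (\<Sum>m<length J. \<Sum>l\<in>UNIV. cpartial r (T I (J[m := l])) x * A $ l $ (J ! m))
     - (\<Sum>m<length I. \<Sum>l\<in>UNIV. cpartial r (T (I[m := l]) J) x * A $ (I ! m) $ l)"
  have d1: "has_cpartial r (T I (J[m := l])) x (cpartial r (T I (J[m := l])) x)"
    and d2: "has_cpartial r (T (I[m := l]) J) x (cpartial r (T (I[m := l]) J) x)" for m l
    by (rule homogeneous_poly_has_cpartial[OF hom], simp, simp)+
  have d3: "has_cpartial r (cpartial s (T I J)) x (cpartial r (cpartial s (T I J)) x)" for s
    by (rule homogeneous_poly_has_cpartial[OF homogeneous_poly_cpartial[OF hom[OF refl refl]]])
  have a0: "axis r (0::complex) = 0"
    by (simp add: axis_def vec_eq_iff)
  have d4: "((\<lambda>t. (A *v (x + axis r t)) $ s * cpartial s (T I J) (x + axis r t))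
      has_field_derivative A $ s $ r * cpartial s (T I J) x
        + (A *v x) $ s * cpartial r (cpartial s (T I J)) x) (at 0)" for s
    using DERIV_mult'[OF has_cpartial_matrix_mult[where A = A and s = r and i = s and x = x] d3[of s]]
    by (simp add: add.commute a0)
  have "has_cpartial r (lie_derivative (\<lambda>x. A *v x) T I J) x ?D"
    unfolding lie_derivative_def cpartial_matrix_mult
    by (intro DERIV_add DERIV_diff DERIV_sum DERIV_cmult_right d4 d1 d2)
  moreover have "?D = lie_derivative (\<lambda>x. A *v x) (gradient_tensor T) I (r # J) x"
    using cpartial_commute[OF hom[OF refl refl], of r]
    by (simp add: lie_derivative_def gradient_tensor_def cpartial_matrix_mult sum.distrib
        sum.lessThan_Suc_shift mult.commute del: sum.lessThan_Suc)
  ultimately show ?thesis by simp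
qed

text \<open>A constant tensor of type \<open>(p, q)\<close> is read as a form with \<open>q\<close> vector slots, followed by \<open>p\<close>
  covector slots.\<close>

lemma constant_invariant_tensor_eigenvalues:
  fixes T :: "'n::finite list \<Rightarrow> 'n list \<Rightarrow> complex"
  assumes inv: "\<And>I J. length I = p \<Longrightarrow> length J = q \<Longrightarrow>
      (\<Sum>m<q. \<Sum>l\<in>UNIV. T I (J[m := l]) * A $ l $ (J ! m))
      = (\<Sum>m<p. \<Sum>l\<in>UNIV. T (I[m := l]) J * A $ (I ! m) $ l)"
    and nz: "length I0 = p" "length J0 = q" "T I0 J0 \<noteq> 0"
  shows "\<exists>\<mu>s \<nu>s. length \<mu>s = p \<and> length \<nu>s = q \<and>
    (\<forall>z\<in>set \<mu>s \<union> set \<nu>s. det (mat z - A) = 0) \<and> sum_list \<nu>s = sum_list \<mu>s"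
proof -
  define C where "C L = T (drop q L) (take q L)" for L
  define Bs where "Bs = replicate q A @ replicate p (- transpose A)"
  have "(\<Sum>m<length Bs. \<Sum>l\<in>UNIV. C (L[m := l]) * (Bs ! m) $ l $ (L ! m)) = 0 * C L"
    if L: "length L = length Bs" for L
  proof -
    define I J where "I = drop q L" "J = take q L"
    have len: "length I = p" "length J = q" using L by (auto simp: I_J_def Bs_def)
    define g where "g m = (\<Sum>l\<in>UNIV. C (L[m := l]) * (Bs ! m) $ l $ (L ! m))" for m
    have "(\<Sum>m<q + p. g m) = (\<Sum>m<q. g m) + (\<Sum>m<p. g (q + m))"
      by (induction p) simp_all
    moreover have "g m = (\<Sum>l\<in>UNIV. T I (J[m := l]) * A $ l $ (J ! m))" if "m < q" for m
      using that by (simp add: g_def C_def Bs_def I_J_def nth_append take_update_swap)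
    moreover have "g (q + m) = - (\<Sum>l\<in>UNIV. T (I[m := l]) J * A $ (I ! m) $ l)" if "m < p" for m
      using that L by (simp add: g_def C_def Bs_def I_J_def nth_append drop_update_swap transpose_def
        sum_negf)
    ultimately have "(\<Sum>m<q + p. g m) = 0"
      using inv[OF len] by (simp add: sum_negf)
    then show ?thesis by (simp add: g_def Bs_def)
  qed
  moreover have "length (J0 @ I0) = length Bs" "C (J0 @ I0) \<noteq> 0"
    using nz by (simp_all add: Bs_def C_def)
  ultimately obtain \<rho>s where \<rho>s: "length \<rho>s = length Bs"
    "\<And>m. m < length Bs \<Longrightarrow> det (mat (\<rho>s ! m) - Bs ! m) = 0" "sum_list \<rho>s = 0"
    using multilinear_eigenvalue_sum[of Bs C 0] by blast
  have len: "length \<rho>s = q + p" using \<rho>s(1) by (simp add: Bs_def)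
  have 1: "det (mat z - A) = 0" if z: "z \<in> set (take q \<rho>s)" for z
  proof -
    obtain m where "m < q" "z = \<rho>s ! m"
      using z len by (auto simp: in_set_conv_nth)
    then show ?thesis using \<rho>s(2)[of m] by (simp add: Bs_def nth_append)
  qed
  have 2: "det (mat (- z) - A) = 0" if z: "z \<in> set (drop q \<rho>s)" for z
  proof -
    obtain m where "m < p" "z = \<rho>s ! (q + m)"
      using z len by (auto simp: in_set_conv_nth)
    then show ?thesis
      using \<rho>s(2)[of "q + m"] by (intro det_eq_0_uminus_transpose) (simp add: Bs_def nth_append)
  qed
  have "sum_list (take q \<rho>s) + sum_list (drop q \<rho>s) = 0"
    using \<rho>s(3) by (simp flip: sum_list_append)
  then have "sum_list (take q \<rho>s) = sum_list (map uminus (drop q \<rho>s))"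
    by (simp add: uminus_sum_list_map[of id, unfolded comp_def, simplified, symmetric]
        eq_neg_iff_add_eq_0)
  then show ?thesis
    using len 1 2 by (intro exI[of _ "map uminus (drop q \<rho>s)"] exI[of _ "take q \<rho>s"]) auto
qed

text \<open>Of the \<open>k + q\<close> numbers \<open>\<nu>s\<close>, the first \<open>k\<close> belong to the slots added by differentiation.\<close>

lemma homogeneous_invariant_tensor_eigenvalues:
  fixes T :: "'n::finite tensor_field"
  assumes hom: "\<And>I J. length I = p \<Longrightarrow> length J = q \<Longrightarrow> homogeneous_poly k (T I J)"
    and inv: "\<And>I J x. length I = p \<Longrightarrow> length J = q \<Longrightarrow> lie_derivative (\<lambda>x. A *v x) T I J x = 0"
    and nz: "length I0 = p" "length J0 = q" "T I0 J0 x0 \<noteq> 0"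
  shows "\<exists>\<mu>s \<nu>s. length \<mu>s = p \<and> length \<nu>s = k + q \<and>
    (\<forall>z\<in>set \<mu>s \<union> set \<nu>s. det (mat z - A) = 0) \<and> sum_list \<nu>s = sum_list \<mu>s"
  using assms
proof (induction k arbitrary: q T J0 x0)
  case 0
  have const: "T I J x = T I J 0" if "length I = p" "length J = q" for I J x
    using that 0 by (intro homogeneous_poly_0_const) auto
  then have "cpartial s (T I J) x = 0" if "length I = p" "length J = q" for s I J x
  proof -
    have "T I J = (\<lambda>x. T I J 0)" using const[OF that] by blast
    then show ?thesis by (metis cpartial_const)
  qed
  then have "(\<Sum>m<q. \<Sum>l\<in>UNIV. T I (J[m := l]) 0 * A $ l $ (J ! m))
      = (\<Sum>m<p. \<Sum>l\<in>UNIV. T (I[m := l]) J 0 * A $ (I ! m) $ l)"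
    if "length I = p" "length J = q" for I J
    using 0(2)[OF that, of 0] that by (simp add: lie_derivative_def cpartial_matrix_mult)
  then show ?case
    using constant_invariant_tensor_eigenvalues[of p q "\<lambda>I J. T I J 0" A I0 J0] 0(3-) const[of I0 J0 x0]
    by auto
next
  case (Suc k)
  let ?T = "gradient_tensor T"
  have "homogeneous_poly k (?T I J)" if "length I = p" "length J = Suc q" for I J
    using homogeneous_poly_cpartial[OF Suc.prems(1)[of I "tl J"]] that
    by (simp add: gradient_tensor_def[abs_def])
  moreover have "lie_derivative (\<lambda>x. A *v x) ?T I J x = 0"
    if len: "length I = p" "length J = Suc q" for I J x
  proof -
    obtain r J' where J: "J = r # J'" "length J' = q" using len(2) by (cases J) auto
    have eq: "lie_derivative (\<lambda>x. A *v x) T I J' = (\<lambda>x. 0)"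
      using Suc.prems(2) len(1) J(2) by auto
    have "has_cpartial r (lie_derivative (\<lambda>x. A *v x) T I J') x
        (lie_derivative (\<lambda>x. A *v x) ?T I (r # J') x)"
      using Suc.prems(1) len(1) J(2) by (intro lie_derivative_gradient[of I J' "Suc k"]) auto
    from cpartial_eqI[OF this] show ?thesis by (simp add: J eq cpartial_zero)
  qed
  moreover obtain s where "?T I0 (s # J0) x0 \<noteq> 0"
  proof -
    have "(\<Sum>s\<in>UNIV. x0 $ s * cpartial s (T I0 J0) x0) \<noteq> 0"
      using euler_homogeneous[OF Suc.prems(1), of I0 J0 x0] Suc.prems(3-)
      by (simp del: of_nat_Suc)
    then obtain s where "x0 $ s * cpartial s (T I0 J0) x0 \<noteq> 0"
      by (rule sum.not_neutral_contains_not_neutral)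
    then show ?thesis using that[of s] by (simp add: gradient_tensor_def)
  qed
  ultimately show ?case
    using Suc.IH[of "Suc q" ?T "s # J0" x0] Suc.prems(3,4) by simp
qed

lemma exists_map_eq:
  assumes "\<And>z. z \<in> set zs \<Longrightarrow> \<exists>i. f i = z"
  shows "\<exists>L. map f L = zs"
  using assms by (metis ex_map_conv)

lemma sum_count_list:
  fixes f :: "'n::finite \<Rightarrow> complex"
  shows "(\<Sum>j\<in>UNIV. of_nat (count_list L j) * f j) = (\<Sum>j\<leftarrow>L. f j)"
proof (induction L)
  case (Cons a L)
  have "(\<Sum>j\<in>UNIV. of_nat (count_list (a # L) j) * f j)
      = (\<Sum>j\<in>UNIV. (if a = j then f j else 0) + of_nat (count_list L j) * f j)"
    by (intro sum.cong) (auto simp: distrib_right)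
  then show ?case using Cons by (simp add: sum.distrib)
qed simp

lemma sum_count_list_length: "(\<Sum>j\<in>UNIV. count_list L j) = length L" for L :: "'n::finite list"
  using sum_count_set[of L UNIV] by simp


section \<open>Analytic functions on complex lines\<close>

lemma norm_scalar_mult: "norm (t *s x) = norm t * norm x" for x :: "complex ^ 'n::finite"
  by (simp add: norm_vec_def norm_mult L2_set_right_distrib)

lemma norm_axis_complex: "norm (axis s t :: complex ^ 'n::finite) = norm t"
proof -
  have "norm (axis s t :: complex ^ 'n) = sqrt (\<Sum>i\<in>UNIV. if i = s then (norm t)\<^sup>2 else 0)"
    unfolding norm_vec_def L2_set_def axis_def
    by (intro arg_cong[where f = sqrt] sum.cong) auto
  then show ?thesis by simp
qed

lemma holomorphic_on_line: "(\<lambda>z. (b + axis l z) $ i) holomorphic_on S"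
  by (cases "i = l") (auto simp: axis_def intro!: holomorphic_intros)

lemma continuous_on_axis: "continuous_on S (axis l :: complex \<Rightarrow> complex ^ 'n::finite)"
proof -
  have "continuous_on S (\<lambda>z::complex. if i = l then z else 0)" for i
    by (cases "i = l") (auto intro!: continuous_intros)
  then show ?thesis unfolding axis_def by (rule continuous_on_vec_lambda)
qed

lemma scalar_mult_axis: "t *s axis s z = axis s (t * z)" for t :: complex
  by (simp add: axis_def vec_eq_iff)

text \<open>On a small ball, the power series converges uniformly along the finite sets of
  multi-indices: absolute convergence at the corner \<open>(\<rho>, \<dots>, \<rho>)\<close> of a polydisc dominates the series
  on the whole polydisc.\<close>

lemma power_series_at_0_uniform:
  fixes f :: "complex ^ 'n::finite \<Rightarrow> complex"
  assumes "power_series_at f 0"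
  obtains \<rho> c where "\<rho> > 0" "uniform_limit (cball 0 \<rho>)
    (\<lambda>S x. \<Sum>\<alpha>\<in>S. c \<alpha> * monomial \<alpha> x) f (finite_subsets_at_top UNIV)"
proof -
  obtain r c where r: "r > 0"
    and c': "\<forall>x\<in>ball 0 r. ((\<lambda>\<alpha>. c \<alpha> * monomial \<alpha> (x - 0)) has_sum f x) UNIV"
    using assms unfolding power_series_at_def by blast
  have c: "((\<lambda>\<alpha>. c \<alpha> * monomial \<alpha> x) has_sum f x) UNIV" if "x \<in> ball 0 r" for x
    using c' that by simp
  define \<rho> where "\<rho> = r / (2 * CARD('n))"
  have \<rho>: "\<rho> > 0" using r by (simp add: \<rho>_def)
  define w :: "complex ^ 'n" where "w = (\<chi> i. of_real \<rho>)"
  have "norm w \<le> (\<Sum>i\<in>UNIV. norm (w $ i))"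
    unfolding norm_vec_def by (rule L2_set_le_sum) auto
  also have "\<dots> = (\<Sum>i\<in>(UNIV :: 'n set). \<rho>)" using \<rho> by (simp add: w_def)
  also have "\<dots> = r / 2" by (simp add: \<rho>_def)
  finally have "w \<in> ball 0 r" using r by simp
  then have "(\<lambda>\<alpha>. c \<alpha> * monomial \<alpha> w) summable_on UNIV"
    using c by (auto simp: summable_on_def)
  then have sum: "(\<lambda>\<alpha>. norm (c \<alpha> * monomial \<alpha> w)) summable_on UNIV"
    by (simp add: summable_on_iff_abs_summable_on_complex)
  have le: "norm (c \<alpha> * monomial \<alpha> x) \<le> norm (c \<alpha> * monomial \<alpha> w)" if "x \<in> cball 0 \<rho>" for \<alpha> x
  proof -
    have "norm (x $ i) \<le> \<rho>" for i
      using Finite_Cartesian_Product.norm_nth_le[of x i] that by simp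
    then show ?thesis
      using \<rho> unfolding norm_mult monomial_def prod_norm[symmetric]
      by (intro mult_left_mono prod_mono) (auto simp: w_def norm_power power_mono)
  qed
  have eq: "infsum (\<lambda>\<alpha>. c \<alpha> * monomial \<alpha> x) UNIV = f x" if "x \<in> cball 0 \<rho>" for x
  proof -
    have "\<rho> < r"
    proof -
      have "1 \<le> real CARD('n)" by (simp add: Suc_leI)
      then have "r * 1 < r * (2 * CARD('n))"
        by (intro mult_strict_left_mono r) linarith
      then show ?thesis using r by (simp add: \<rho>_def divide_less_eq)
    qed
    then show ?thesis using that by (intro infsumI c) auto
  qed
  have "uniform_limit (cball 0 \<rho>) (\<lambda>S x. \<Sum>\<alpha>\<in>S. c \<alpha> * monomial \<alpha> x)
      (\<lambda>x. infsum (\<lambda>\<alpha>. c \<alpha> * monomial \<alpha> x) UNIV) (finite_subsets_at_top UNIV)"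
    by (rule Weierstrass_m_test_general[OF le sum])
  then have "uniform_limit (cball 0 \<rho>)
    (\<lambda>S x. \<Sum>\<alpha>\<in>S. c \<alpha> * monomial \<alpha> x) f (finite_subsets_at_top UNIV)"
    using eq unfolding uniform_limit_iff by simp
  then show ?thesis using that \<rho> by blast
qed

text \<open>Holomorphy in several variables enters only through its consequence along holomorphic
  curves \<open>\<gamma>\<close>.\<close>

lemma power_series_at_0_holomorphic:
  fixes f :: "complex ^ 'n::finite \<Rightarrow> complex"
  assumes "power_series_at f 0"
  obtains \<rho> where "\<rho> > 0" "continuous_on (cball 0 \<rho>) f"
    "\<And>\<gamma> S. open S \<Longrightarrow> (\<And>i. (\<lambda>z. \<gamma> z $ i) holomorphic_on S) \<Longrightarrow> \<gamma> ` S \<subseteq> cball 0 \<rho> \<Longrightarrow>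
      (\<lambda>z. f (\<gamma> z)) holomorphic_on S"
proof -
  obtain \<rho> c where \<rho>: "\<rho> > 0" and lim: "uniform_limit (cball 0 \<rho>)
    (\<lambda>S x. \<Sum>\<alpha>\<in>S. c \<alpha> * monomial \<alpha> x) f (finite_subsets_at_top UNIV)"
    using power_series_at_0_uniform[OF assms] .
  have "continuous_on (cball 0 \<rho>) f"
    by (rule uniform_limit_theorem[OF _ lim])
       (auto simp: monomial_def intro!: always_eventually continuous_intros)
  moreover have "(\<lambda>z. f (\<gamma> z)) holomorphic_on S"
    if S: "open S" and \<gamma>: "\<And>i. (\<lambda>z. \<gamma> z $ i) holomorphic_on S" "\<gamma> ` S \<subseteq> cball 0 \<rho>" for \<gamma> S
  proof -
    have "(\<lambda>z. f (\<gamma> z)) field_differentiable (at z)" if z: "z \<in> S" for z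
    proof -
      obtain e where e: "e > 0" "cball z e \<subseteq> S" using S z open_contains_cball by blast
      have hol: "(\<lambda>z. \<Sum>\<alpha>\<in>X. c \<alpha> * monomial \<alpha> (\<gamma> z)) holomorphic_on S" for X
        unfolding monomial_def by (intro holomorphic_intros \<gamma>)
      have lim': "uniform_limit (cball z e) (\<lambda>X z. \<Sum>\<alpha>\<in>X. c \<alpha> * monomial \<alpha> (\<gamma> z)) (\<lambda>z. f (\<gamma> z))
          (finite_subsets_at_top UNIV)"
        using lim e(2) \<gamma>(2) unfolding uniform_limit_iff
        by (fast elim!: eventually_mono)
      have "ball z e \<subseteq> S" using e(2) ball_subset_cball by blast
      then have "\<forall>X. continuous_on (cball z e) (\<lambda>z. \<Sum>\<alpha>\<in>X. c \<alpha> * monomial \<alpha> (\<gamma> z)) \<and>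
          (\<lambda>z. \<Sum>\<alpha>\<in>X. c \<alpha> * monomial \<alpha> (\<gamma> z)) holomorphic_on ball z e"
        using holomorphic_on_subset[OF hol] holomorphic_on_imp_continuous_on e(2) by blast
      then have "(\<lambda>z. f (\<gamma> z)) holomorphic_on ball z e"
        by (rule holomorphic_uniform_limit[OF always_eventually lim' finite_subsets_at_top_neq_bot])
      then show ?thesis
        using e(1) by (auto intro: holomorphic_on_imp_differentiable_at)
    qed
    then show ?thesis
      by (simp add: holomorphic_on_def field_differentiable_at_within)
  qed
  ultimately show ?thesis using that \<rho> by blast
qed

lemma deriv_tendsto_uniform_limit:
  fixes \<Phi> :: "'a \<Rightarrow> complex \<Rightarrow> complex"
  assumes "\<forall>\<^sub>F t in X. continuous_on (cball 0 r) (\<Phi> t) \<and> \<Phi> t holomorphic_on ball 0 r"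
    and lim: "uniform_limit (cball 0 r) \<Phi> g X" and X: "X \<noteq> bot" and r: "r > 0"
  shows "((\<lambda>t. deriv (\<Phi> t) 0) \<longlongrightarrow> deriv g 0) X"
proof -
  have "\<forall>\<^sub>F t in X. continuous_on (cball 0 r) (\<Phi> t) \<and>
      (\<forall>w\<in>ball 0 r. (\<Phi> t has_field_derivative deriv (\<Phi> t) w) (at w))"
    using assms(1) by (auto elim!: eventually_mono intro: holomorphic_derivI)
  then obtain g' where g': "\<And>w. w \<in> ball 0 r \<Longrightarrow>
      (g has_field_derivative g' w) (at w) \<and> ((\<lambda>t. deriv (\<Phi> t) w) \<longlongrightarrow> g' w) X"
    by (rule has_complex_derivative_uniform_limit[OF _ lim X r]) blast
  then have "(g has_field_derivative g' 0) (at 0)" "((\<lambda>t. deriv (\<Phi> t) 0) \<longlongrightarrow> g' 0) X"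
    using r by auto
  then show ?thesis by (simp add: DERIV_imp_deriv)
qed


section \<open>The leading term of an invariant tensor\<close>

text \<open>The point of the bound is its uniformity: for given \<open>k\<close>, it depends on \<open>\<phi>\<close> only
  through \<open>M\<close> and \<open>R\<close>. The coefficients \<open>h r\<close> satisfy Cauchy's estimates.\<close>

lemma leading_term_bound:
  fixes \<phi> :: "complex \<Rightarrow> complex"
  assumes hol: "\<phi> holomorphic_on ball 0 R" and cont: "continuous_on (cball 0 R) \<phi>" and R: "R > 0"
    and M: "\<And>t. t \<in> cball 0 R \<Longrightarrow> norm (\<phi> t) \<le> M"
    and sums: "\<forall>\<^sub>F t in nhds 0. (\<lambda>r. h r * t ^ (k + r)) sums \<phi> t"
    and t: "t \<noteq> 0" "norm t \<le> R / 2"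
  shows "norm (\<phi> t / t ^ k - h 0) \<le> 2 * M / R ^ (k + 1) * norm t"
proof -
  define b where "b n = (if n < k then 0 else h (n - k))" for n
  have shift: "(\<lambda>n. b n * t ^ n) sums z \<longleftrightarrow> (\<lambda>r. h r * t ^ (k + r)) sums z" for t z
    using sums_zero_iff_shift[of k "\<lambda>n. b n * t ^ n" z] by (simp add: b_def add.commute)
  have "\<phi> has_fps_expansion Abs_fps b"
    using sums by (intro has_fps_expansionI) (simp add: shift)
  then have b: "b n = (deriv ^^ n) \<phi> 0 / fact n" for n
    using fps_nth_fps_expansion by fastforce
  have b_le: "norm (b n) \<le> M / R ^ n" for n
  proof -
    have "norm ((deriv ^^ n) \<phi> 0) \<le> fact n * M / R ^ n"
      by (rule Cauchy_inequality[OF hol cont R]) (use M in auto)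
    then show ?thesis by (simp add: b norm_divide field_simps)
  qed
  have "(\<lambda>n. b n * t ^ n) sums \<phi> t"
    using holomorphic_power_series[OF hol, of t] t R by (simp add: b)
  then have "(\<lambda>r. h r * t ^ (k + r) / t ^ k) sums (\<phi> t / t ^ k)"
    by (intro sums_divide) (simp add: shift)
  then have "(\<lambda>r. h r * t ^ r) sums (\<phi> t / t ^ k)"
    using t by (simp add: power_add)
  then have s: "(\<lambda>r. h (Suc r) * t ^ Suc r) sums (\<phi> t / t ^ k - h 0)"
    by (subst sums_Suc_iff) simp
  have le: "norm (h (Suc r) * t ^ Suc r) \<le> M / R ^ (k + 1) * norm t * (1 / 2) ^ r" for r
  proof -
    have "norm (\<phi> 0) \<le> M" using R by (intro M) simp
    then have "M \<ge> 0" using norm_ge_zero order_trans by blast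
    have "norm (h (Suc r) * t ^ Suc r) = norm (b (k + Suc r)) * norm t ^ Suc r"
      by (simp add: b_def norm_mult norm_power)
    also have "\<dots> \<le> M / R ^ (k + Suc r) * norm t ^ Suc r"
      by (intro mult_right_mono b_le) auto
    also have "\<dots> = M / R ^ (k + 1) * norm t * (norm t / R) ^ r"
      by (simp add: power_add power_divide)
    also have "\<dots> \<le> M / R ^ (k + 1) * norm t * (1 / 2) ^ r"
      using \<open>M \<ge> 0\<close> t R by (intro mult_left_mono power_mono) (auto simp: field_simps)
    finally show ?thesis .
  qed
  have g: "(\<lambda>r. M / R ^ (k + 1) * norm t * (1 / 2) ^ r) sums (M / R ^ (k + 1) * norm t * 2)"
    using sums_mult[OF geometric_sums[of "1 / 2 :: real"], where c = "M / R ^ (k + 1) * norm t"]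
    by simp
  have "norm (\<Sum>r. h (Suc r) * t ^ Suc r) \<le> (\<Sum>r. M / R ^ (k + 1) * norm t * (1 / 2) ^ r)"
    by (rule norm_suminf_le[OF le sums_summable[OF g]])
  then show ?thesis
    using s g by (simp add: sums_iff mult_ac)
qed

text \<open>The one-variable functions \<open>t \<mapsto> T(t y)\<close>, for \<open>y\<close> in a fixed ball, share the bound \<open>M\<close> on a
  common disc.\<close>

lemma rescaled_uniform_limit:
  fixes T :: "complex ^ 'n::finite \<Rightarrow> complex"
  assumes T: "power_series_at T 0"
    and H: "\<And>r. homogeneous_poly (k + r) (H r)"
    and sums: "\<forall>\<^sub>F x in nhds 0. (\<lambda>r. H r x) sums T x"
  shows "uniform_limit (cball 0 B) (\<lambda>t y. T (t *s y) / t ^ k) (H 0) (at 0)"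
proof -
  obtain \<rho> where \<rho>: "\<rho> > 0" and cont: "continuous_on (cball 0 \<rho>) T"
    and hol: "\<And>\<gamma> S. open S \<Longrightarrow> (\<And>i. (\<lambda>z. \<gamma> z $ i) holomorphic_on S) \<Longrightarrow> \<gamma> ` S \<subseteq> cball 0 \<rho> \<Longrightarrow>
      (\<lambda>z. T (\<gamma> z)) holomorphic_on S"
    using power_series_at_0_holomorphic[OF T] by blast
  obtain M where M: "\<And>x. x \<in> cball 0 \<rho> \<Longrightarrow> norm (T x) \<le> M"
    using compact_imp_bounded[OF compact_continuous_image[OF cont compact_cball]]
    unfolding bounded_iff by blast
  define R where "R = \<rho> / (\<bar>B\<bar> + 1)"
  have R: "R > 0" using \<rho> by (simp add: R_def)
  have sub: "t *s y \<in> cball 0 \<rho>" if "norm t \<le> R" "norm y \<le> B" for t and y :: "complex ^ 'n"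
  proof -
    have "norm t * norm y \<le> R * (\<bar>B\<bar> + 1)" using that R by (intro mult_mono) auto
    then show ?thesis by (simp add: norm_scalar_mult R_def)
  qed
  have bound: "norm (T (t *s y) / t ^ k - H 0 y) \<le> 2 * M / R ^ (k + 1) * norm t"
    if t: "t \<noteq> 0" "norm t \<le> R / 2" and y: "y \<in> cball 0 B" for t y
  proof (rule leading_term_bound[where \<phi> = "\<lambda>t. T (t *s y)" and h = "\<lambda>r. H r y", OF _ _ R _ _ t])
    show "(\<lambda>t. T (t *s y)) holomorphic_on ball 0 R"
      using sub y by (intro hol) (auto intro!: holomorphic_intros)
    show "continuous_on (cball 0 R) (\<lambda>t. T (t *s y))"
      using sub y by (intro continuous_on_compose2[OF cont])
        (auto intro!: continuous_intros simp: vector_scalar_mult_def)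
    show "norm (T (t *s y)) \<le> M" if "t \<in> cball 0 R" for t
      using that y by (intro M sub) auto
    have "((\<lambda>t. t *s y) \<longlongrightarrow> 0) (nhds 0)"
      by (rule vec_tendstoI) (auto intro!: tendsto_mult_left_zero filterlim_ident)
    from eventually_compose_filterlim[OF sums this]
    show "\<forall>\<^sub>F t in nhds 0. (\<lambda>r. H r y * t ^ (k + r)) sums T (t *s y)"
      by (simp add: homogeneous_poly_scale[OF H] mult.commute)
  qed
  show ?thesis
    unfolding uniform_limit_iff
  proof (intro allI impI)
    fix e :: real assume e: "e > 0"
    have "((\<lambda>t::complex. 2 * M / R ^ (k + 1) * norm t) \<longlongrightarrow> 0) (at 0)"
      by (intro tendsto_mult_right_zero tendsto_norm_zero tendsto_ident_at)
    then have "\<forall>\<^sub>F t in at (0::complex). 2 * M / R ^ (k + 1) * norm t < e"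
      by (rule order_tendstoD) (rule e)
    moreover have "\<forall>\<^sub>F t in at (0::complex). t \<noteq> 0 \<and> norm t \<le> R / 2"
      using R by (auto simp: eventually_at intro!: exI[of _ "R / 2"])
    ultimately show "\<forall>\<^sub>F t in at 0. \<forall>y\<in>cball 0 B. dist (T (t *s y) / t ^ k) (H 0 y) < e"
      by eventually_elim (use bound in \<open>force simp: dist_norm\<close>)
  qed
qed

text \<open>As a function of \<open>z\<close>, the rescaled \<open>T(t (x + z e\<^sub>s)) / t\<^sup>k\<close> converges uniformly on the unit
  disc, so its derivative at \<open>z = 0\<close> converges; the chain rule contributes the factor \<open>t\<close>.\<close>

lemma rescaled_cpartial_tendsto:
  fixes T :: "complex ^ 'n::finite \<Rightarrow> complex"
  assumes T: "power_series_at T 0"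
    and H: "\<And>r. homogeneous_poly (k + r) (H r)"
    and sums: "\<forall>\<^sub>F x in nhds 0. (\<lambda>r. H r x) sums T x"
  shows "((\<lambda>t. t * cpartial s T (t *s x) / t ^ k) \<longlongrightarrow> cpartial s (H 0) x) (at 0)"
proof -
  obtain \<rho> where \<rho>: "\<rho> > 0" and cont: "continuous_on (cball 0 \<rho>) T"
    and hol: "\<And>\<gamma> S. open S \<Longrightarrow> (\<And>i. (\<lambda>z. \<gamma> z $ i) holomorphic_on S) \<Longrightarrow> \<gamma> ` S \<subseteq> cball 0 \<rho> \<Longrightarrow>
      (\<lambda>z. T (\<gamma> z)) holomorphic_on S"
    using power_series_at_0_holomorphic[OF T] by blast
  \<comment> \<open>\<open>B\<close> bounds \<open>x + z e\<^sub>s\<close> for \<open>z\<close> in the unit disc.\<close>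
  define B where "B = norm x + 1"
  define \<Phi> where "\<Phi> t z = T (t *s (x + axis s z)) / t ^ k" for t z
  have B: "norm (x + axis s z) \<le> B" if "norm z \<le> 1" for z
    using norm_triangle_ineq[of x "axis s z"] that by (simp add: B_def norm_axis_complex)
  have small: "\<forall>\<^sub>F t in at (0::complex). t \<noteq> 0 \<and> norm t * B < \<rho>"
  proof -
    have "((\<lambda>t::complex. norm t * B) \<longlongrightarrow> 0) (at 0)"
      by (auto intro!: tendsto_eq_intros)
    then have "\<forall>\<^sub>F t in at (0::complex). norm t * B < \<rho>" by (rule order_tendstoD) (rule \<rho>)
    then show ?thesis by (auto simp: eventually_at_filter elim: eventually_mono)
  qed
  have sub: "t *s (x + axis s z) \<in> cball 0 \<rho>" if "norm t * B < \<rho>" "norm z \<le> 1" for t z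
  proof -
    have "norm t * norm (x + axis s z) \<le> norm t * B"
      by (intro mult_left_mono B that) auto
    then have "norm (t *s (x + axis s z)) \<le> \<rho>"
      using that unfolding norm_scalar_mult by linarith
    then show ?thesis by simp
  qed
  have "uniform_limit (cball 0 1) \<Phi> (\<lambda>z. H 0 (x + axis s z)) (at 0)"
    using rescaled_uniform_limit[OF assms, of B] B unfolding uniform_limit_iff \<Phi>_def
    by (fastforce elim!: eventually_mono)
  moreover have "\<forall>\<^sub>F t in at 0. continuous_on (cball 0 1) (\<Phi> t) \<and> \<Phi> t holomorphic_on ball 0 1"
    using small
  proof eventually_elim
    case (elim t)
    have eq: "t *s (x + axis s z) = t *s x + axis s (t * z)" for z
      by (simp only: vec.scale_right_distrib scalar_mult_axis)
    have "t *s x + axis s (t * z) \<in> cball 0 \<rho>" if "norm z \<le> 1" for z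
      using sub[of t z] elim that unfolding eq by blast
    then have "continuous_on (cball 0 1) (\<lambda>z. T (t *s (x + axis s z)))"
      unfolding eq
      by (intro continuous_on_compose2[OF cont] continuous_intros
        continuous_on_compose2[OF continuous_on_axis]) auto
    moreover have "(\<lambda>z. T (t *s (x + axis s z))) holomorphic_on ball 0 1"
    proof (rule hol)
      show "(\<lambda>z. t *s (x + axis s z)) ` ball 0 1 \<subseteq> cball 0 \<rho>"
      proof clarify
        fix z :: complex assume "z \<in> ball 0 1"
        then show "t *s (x + axis s z) \<in> cball 0 \<rho>" using elim by (intro sub) auto
      qed
      show "(\<lambda>z. (t *s (x + axis s z)) $ i) holomorphic_on ball 0 1" for i
        unfolding vector_smult_component by (intro holomorphic_intros holomorphic_on_line)
    qed simp
    ultimately show ?case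
      unfolding \<Phi>_def using elim by (intro conjI continuous_intros holomorphic_intros) auto
  qed
  ultimately have lim: "((\<lambda>t. deriv (\<Phi> t) 0) \<longlongrightarrow> cpartial s (H 0) x) (at 0)"
    unfolding cpartial_def by (intro deriv_tendsto_uniform_limit[where r = 1]) auto
  have "\<forall>\<^sub>F t in at 0. deriv (\<Phi> t) 0 = t * cpartial s T (t *s x) / t ^ k"
    using small
  proof eventually_elim
    case (elim t)
    define \<psi> where "\<psi> u = T (t *s x + axis s u)" for u :: complex
    define e where "e = \<rho> - norm t * norm x"
    have "norm t * norm x \<le> norm t * B" by (intro mult_left_mono) (auto simp: B_def)
    moreover have "norm t * B < \<rho>" using elim by blast
    ultimately have e: "e > 0" unfolding e_def by linarith
    have "\<psi> holomorphic_on ball 0 e"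
      unfolding \<psi>_def
    proof (rule hol)
      show "(\<lambda>u. t *s x + axis s u) ` ball 0 e \<subseteq> cball 0 \<rho>"
      proof clarify
        fix u :: complex assume "u \<in> ball 0 e"
        then show "t *s x + axis s u \<in> cball 0 \<rho>"
          using norm_triangle_ineq[of "t *s x" "axis s u"]
          by (simp add: e_def norm_scalar_mult norm_axis_complex)
      qed
    qed (auto simp del: vector_add_component intro!: holomorphic_on_line)
    then have "(\<psi> has_field_derivative deriv \<psi> 0) (at (t * 0))"
      using e by (auto intro: holomorphic_derivI)
    then have "((\<lambda>z. \<psi> (t * z)) has_field_derivative deriv \<psi> 0 * t) (at 0)"
      by (rule DERIV_chain2) (auto intro!: derivative_eq_intros)
    then have "((\<lambda>z. \<psi> (t * z) / t ^ k) has_field_derivative deriv \<psi> 0 * t / t ^ k) (at 0)"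
      by (rule DERIV_cdivide)
    moreover have "\<Phi> t = (\<lambda>z. \<psi> (t * z) / t ^ k)"
      by (simp add: \<Phi>_def \<psi>_def vec.scale_right_distrib scalar_mult_axis fun_eq_iff)
    ultimately show ?case
      by (simp add: DERIV_imp_deriv cpartial_def \<psi>_def[abs_def] mult.commute)
  qed
  from Lim_transform_eventually[OF lim this] show ?thesis .
qed

lemma cpartial_tendsto:
  fixes G :: "complex ^ 'n::finite \<Rightarrow> complex"
  assumes G: "power_series_at G 0"
  shows "((\<lambda>t. cpartial l G (t *s x)) \<longlongrightarrow> cpartial l G 0) (at 0)"
proof -
  obtain \<rho> where \<rho>: "\<rho> > 0" and cont: "continuous_on (cball 0 \<rho>) G"
    and hol: "\<And>\<gamma> S. open S \<Longrightarrow> (\<And>i. (\<lambda>z. \<gamma> z $ i) holomorphic_on S) \<Longrightarrow> \<gamma> ` S \<subseteq> cball 0 \<rho> \<Longrightarrow>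
      (\<lambda>z. G (\<gamma> z)) holomorphic_on S"
    using power_series_at_0_holomorphic[OF G] by blast
  define r where "r = \<rho> / 2"
  have r: "r > 0" using \<rho> by (simp add: r_def)
  define \<Phi> where "\<Phi> t z = G (t *s x + axis l z)" for t z
  have tend: "((\<lambda>t::complex. norm t * norm x) \<longlongrightarrow> 0) (at 0)"
    by (auto intro!: tendsto_eq_intros)
  have small: "\<forall>\<^sub>F t in at (0::complex). norm t * norm x < r"
    using tend r by (rule order_tendstoD)
  have sub: "t *s x + axis l z \<in> cball 0 \<rho>" if "norm t * norm x < r" "norm z \<le> r" for t z
    using norm_triangle_ineq[of "t *s x" "axis l z"] that
    by (simp add: norm_scalar_mult norm_axis_complex r_def)
  have "uniform_limit (cball 0 r) \<Phi> (\<lambda>z. G (0 + axis l z)) (at 0)"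
    unfolding uniform_limit_iff
  proof (intro allI impI)
    fix e :: real assume "e > 0"
    moreover have "uniformly_continuous_on (cball 0 \<rho>) G"
      by (rule compact_uniformly_continuous[OF cont compact_cball])
    ultimately obtain d where d: "d > 0"
      "\<And>y y'. y \<in> cball 0 \<rho> \<Longrightarrow> y' \<in> cball 0 \<rho> \<Longrightarrow> dist y' y < d \<Longrightarrow> dist (G y') (G y) < e"
      unfolding uniformly_continuous_on_def by metis
    have "\<forall>\<^sub>F t in at (0::complex). norm t * norm x < d"
      using tend d(1) by (rule order_tendstoD)
    with small show "\<forall>\<^sub>F t in at 0. \<forall>z\<in>cball 0 r. dist (\<Phi> t z) (G (0 + axis l z)) < e"
    proof eventually_elim
      case (elim t)
      show ?case
        unfolding \<Phi>_def
      proof (intro ballI d(2))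
        fix z :: complex assume z: "z \<in> cball 0 r"
        then show "0 + axis l z \<in> cball 0 \<rho>" using r by (simp add: norm_axis_complex r_def)
        show "t *s x + axis l z \<in> cball 0 \<rho>" using sub elim z by auto
        show "dist (t *s x + axis l z) (0 + axis l z) < d"
          using elim by (simp add: dist_norm norm_scalar_mult)
      qed
    qed
  qed
  moreover have "\<forall>\<^sub>F t in at 0. continuous_on (cball 0 r) (\<Phi> t) \<and> \<Phi> t holomorphic_on ball 0 r"
    using small
  proof eventually_elim
    case (elim t)
    have "continuous_on (cball 0 r) (\<Phi> t)"
      using elim sub unfolding \<Phi>_def
      by (intro continuous_on_compose2[OF cont] continuous_intros continuous_on_axis) auto
    moreover have "\<Phi> t holomorphic_on ball 0 r"
      unfolding \<Phi>_def by (intro hol holomorphic_on_line) (use elim sub in auto)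
    ultimately show ?case by blast
  qed
  ultimately show ?thesis
    using deriv_tendsto_uniform_limit[of r \<Phi>] r unfolding \<Phi>_def cpartial_def by auto
qed

lemma rescaled_field_tendsto:
  fixes F f :: "complex ^ 'n::finite \<Rightarrow> complex ^ 'n"
  assumes U: "open U" "0 \<in> U" and F_eq: "\<And>x. x \<in> U \<Longrightarrow> F x = A *v x + f x"
    and f: "(\<lambda>x. norm (f x)) \<in> O[nhds 0](\<lambda>x. (norm x)\<^sup>2)"
  shows "((\<lambda>t. F (t *s x) $ s / t) \<longlongrightarrow> (A *v x) $ s) (at 0)"
proof -
  obtain C where C: "\<forall>\<^sub>F y in nhds 0. norm (f y) \<le> C * (norm y)\<^sup>2"
    using landau_o.bigE[OF f] by auto
  have lim: "((\<lambda>t. t *s x) \<longlongrightarrow> 0) (at (0::complex))"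
    by (rule vec_tendstoI) (auto intro!: tendsto_mult_left_zero tendsto_ident_at)
  have U': "\<forall>\<^sub>F y in nhds 0. y \<in> U" using U eventually_nhds by blast
  have "\<forall>\<^sub>F t in at (0::complex). t \<noteq> 0" by (simp add: eventually_at_filter)
  then have "\<forall>\<^sub>F t in at (0::complex).
      norm (F (t *s x) $ s / t - (A *v x) $ s) \<le> C * (norm x)\<^sup>2 * norm t"
    using eventually_compose_filterlim[OF C lim] eventually_compose_filterlim[OF U' lim]
  proof eventually_elim
    case (elim t)
    have "F (t *s x) $ s = t * (A *v x) $ s + f (t *s x) $ s"
      using F_eq[OF elim(3)] by (simp add: matrix_vector_mult_scaleR vec.scale)
    then have "norm (F (t *s x) $ s / t - (A *v x) $ s) = norm (f (t *s x) $ s) / norm t"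
      using elim(1) by (simp add: field_simps norm_divide)
    also have "\<dots> \<le> norm (f (t *s x)) / norm t"
      by (intro divide_right_mono Finite_Cartesian_Product.norm_nth_le) auto
    also have "\<dots> \<le> C * (norm (t *s x))\<^sup>2 / norm t"
      using elim(2) by (intro divide_right_mono) auto
    also have "\<dots> = C * (norm x)\<^sup>2 * norm t"
      using elim(1) by (simp add: norm_scalar_mult power_mult_distrib power2_eq_square)
    finally show ?case .
  qed
  moreover have "((\<lambda>t::complex. C * (norm x)\<^sup>2 * norm t) \<longlongrightarrow> 0) (at 0)"
    by (intro tendsto_mult_right_zero tendsto_norm_zero tendsto_ident_at)
  ultimately have "((\<lambda>t. F (t *s x) $ s / t - (A *v x) $ s) \<longlongrightarrow> 0) (at 0)"
    by (rule Lim_null_comparison)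
  then show ?thesis by (simp add: LIM_zero_iff)
qed

text \<open>In the terms \<open>F\<^sup>s \<partial>\<^sub>s T\<close>, the divisor \<open>t\<^sup>k\<close> is split as \<open>t\<close> for \<open>F\<^sup>s\<close> and \<open>t\<^sup>k\<^sup>-\<^sup>1\<close> for \<open>\<partial>\<^sub>s T\<close>.\<close>

lemma lie_derivative_leading_term:
  fixes F f :: "complex ^ 'n::finite \<Rightarrow> complex ^ 'n"
    and H :: "nat \<Rightarrow> 'n tensor_field"
  assumes U: "open U" "0 \<in> U" and F_eq: "\<And>x. x \<in> U \<Longrightarrow> F x = A *v x + f x"
    and F: "\<And>i. power_series_at (\<lambda>x. F x $ i) 0"
    and A: "A = cjacobian F 0"
    and f: "(\<lambda>x. norm (f x)) \<in> O[nhds 0](\<lambda>x. (norm x)\<^sup>2)"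
    and T: "\<And>I J. length I = p \<Longrightarrow> length J = q \<Longrightarrow> power_series_at (T I J) 0"
    and H: "\<And>I J r. length I = p \<Longrightarrow> length J = q \<Longrightarrow> homogeneous_poly (k + r) (H (k + r) I J)"
    and sums: "\<And>I J. length I = p \<Longrightarrow> length J = q \<Longrightarrow>
      \<forall>\<^sub>F x in nhds 0. (\<lambda>r. H (k + r) I J x) sums T I J x"
    and I: "length I = p" and J: "length J = q"
  shows "((\<lambda>t. lie_derivative F T I J (t *s x) / t ^ k)
    \<longlongrightarrow> lie_derivative (\<lambda>x. A *v x) (H k) I J x) (at 0)"
proof -
  have T_lim: "((\<lambda>t. T I J (t *s x) / t ^ k) \<longlongrightarrow> H k I J x) (at 0)"
    and dT_lim: "((\<lambda>t. t * cpartial s (T I J) (t *s x) / t ^ k) \<longlongrightarrow> cpartial s (H k I J) x) (at 0)"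
    if "length I = p" "length J = q" for I J s
  proof -
    note hyps = T[OF that] H[OF that] sums[OF that]
    have "x \<in> cball 0 (norm x)" by simp
    from tendsto_uniform_limitI[OF rescaled_uniform_limit[OF hyps] this]
    show "((\<lambda>t. T I J (t *s x) / t ^ k) \<longlongrightarrow> H k I J x) (at 0)" by simp
    from rescaled_cpartial_tendsto[OF hyps, of s x]
    show "((\<lambda>t. t * cpartial s (T I J) (t *s x) / t ^ k) \<longlongrightarrow> cpartial s (H k I J) x) (at 0)"
      by simp
  qed
  have dF_lim: "((\<lambda>t. cpartial l (\<lambda>y. F y $ i) (t *s x)) \<longlongrightarrow> A $ i $ l) (at 0)" for i l
    using cpartial_tendsto[OF F] unfolding A by (simp add: cjacobian_def)
  have "((\<lambda>t. (\<Sum>s\<in>UNIV. (F (t *s x) $ s / t) * (t * cpartial s (T I J) (t *s x) / t ^ k))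
     + (\<Sum>m<length J. \<Sum>l\<in>UNIV. (T I (J[m := l]) (t *s x) / t ^ k) * cpartial (J ! m) (\<lambda>y. F y $ l) (t *s x))
     - (\<Sum>m<length I. \<Sum>l\<in>UNIV. (T (I[m := l]) J (t *s x) / t ^ k) * cpartial l (\<lambda>y. F y $ (I ! m)) (t *s x)))
    \<longlongrightarrow> lie_derivative (\<lambda>x. A *v x) (H k) I J x) (at 0)"
    unfolding lie_derivative_def cpartial_matrix_mult
    by (intro tendsto_add tendsto_diff tendsto_sum tendsto_mult dF_lim T_lim dT_lim
        rescaled_field_tendsto[OF U F_eq f]) (simp_all add: I J)
  moreover have "\<forall>\<^sub>F t in at (0::complex). t \<noteq> 0" by (simp add: eventually_at_filter)
  then have "\<forall>\<^sub>F t in at 0.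
      (\<Sum>s\<in>UNIV. (F (t *s x) $ s / t) * (t * cpartial s (T I J) (t *s x) / t ^ k))
     + (\<Sum>m<length J. \<Sum>l\<in>UNIV. (T I (J[m := l]) (t *s x) / t ^ k) * cpartial (J ! m) (\<lambda>y. F y $ l) (t *s x))
     - (\<Sum>m<length I. \<Sum>l\<in>UNIV. (T (I[m := l]) J (t *s x) / t ^ k) * cpartial l (\<lambda>y. F y $ (I ! m)) (t *s x))
     = lie_derivative F T I J (t *s x) / t ^ k"
    by eventually_elim
       (simp add: lie_derivative_def add_divide_distrib diff_divide_distrib sum_divide_distrib)
  ultimately show ?thesis by (rule Lim_transform_eventually)
qed

theorem theorem2p8:
  fixes F f :: "complex ^ 'n::finite \<Rightarrow> complex ^ 'n"
    and A :: "complex ^ 'n ^ 'n"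
    and ev :: "'n \<Rightarrow> complex"
    and U :: "(complex ^ 'n) set"
    and p q k :: nat
  assumes U: "open U" "0 \<in> U"
    and F_analytic: "analytic_field_on F U"
    and F_eq: "\<And>x. x \<in> U \<Longrightarrow> F x = A *v x + f x"
    and A_jacobian: "A = cjacobian F 0"
    and f_bigo: "(\<lambda>x. norm (f x)) \<in> O[nhds 0](\<lambda>x. (norm x)\<^sup>2)"
    and ev: "eigenvalue_family A ev"
    and invariant: "\<exists>T V. open V \<and> 0 \<in> V \<and> V \<subseteq> U \<and> analytic_tensor_on p q T V \<and>
      tensor_invariant_on p q F T V \<and> tensor_order p q T k"
  shows "\<exists>(I :: 'n list) (J :: 'n list) (\<kappa> :: 'n \<Rightarrow> nat).
    length I = p \<and> length J = q \<and> (\<Sum>j\<in>UNIV. \<kappa> j) = k \<and>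
    (\<Sum>j\<in>UNIV. of_nat (\<kappa> j) * ev j) = (\<Sum>i\<leftarrow>I. ev i) - (\<Sum>j\<leftarrow>J. ev j)"
proof -
  obtain T V where V: "open V" "0 \<in> V" and "analytic_tensor_on p q T V"
    and inv: "tensor_invariant_on p q F T V" and "tensor_order p q T k"
    using invariant by blast
  then have T: "power_series_at (T I J) 0" if "length I = p" "length J = q" for I J
    using that by (auto simp: analytic_tensor_on_def analytic_fun_on_def)
  have F: "power_series_at (\<lambda>x. F x $ i) 0" for i
    using F_analytic U by (auto simp: analytic_field_on_def analytic_fun_on_def)
  obtain H I0 J0 x0 where H: "\<And>I J r. length I = p \<Longrightarrow> length J = q \<Longrightarrow> k \<le> r \<Longrightarrow>
      homogeneous_poly r (H r I J)"
    and sums: "\<And>I J. length I = p \<Longrightarrow> length J = q \<Longrightarrow>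
      \<forall>\<^sub>F x in nhds 0. (\<lambda>r. H (k + r) I J x) sums T I J x"
    and nz: "length I0 = p" "length J0 = q" "H k I0 J0 x0 \<noteq> 0"
    using \<open>tensor_order p q T k\<close> unfolding tensor_order_def by blast
  have "lie_derivative (\<lambda>x. A *v x) (H k) I J x = 0"
    if IJ: "length I = p" "length J = q" for I J x
  proof -
    have "((\<lambda>t. t *s x) \<longlongrightarrow> 0) (at (0::complex))"
      by (rule vec_tendstoI) (auto intro!: tendsto_mult_left_zero tendsto_ident_at)
    moreover have "\<forall>\<^sub>F y in nhds 0. y \<in> V" using V eventually_nhds by blast
    ultimately have "\<forall>\<^sub>F t in at (0::complex). t *s x \<in> V"
      by (rule eventually_compose_filterlim[rotated])
    then have "\<forall>\<^sub>F t in at 0. lie_derivative F T I J (t *s x) / t ^ k = 0"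
      by eventually_elim (use inv IJ in \<open>auto simp: tensor_invariant_on_def\<close>)
    then have "((\<lambda>t. lie_derivative F T I J (t *s x) / t ^ k) \<longlongrightarrow> 0) (at 0)"
      by (rule tendsto_eventually)
    moreover have "((\<lambda>t. lie_derivative F T I J (t *s x) / t ^ k)
        \<longlongrightarrow> lie_derivative (\<lambda>x. A *v x) (H k) I J x) (at 0)"
      by (rule lie_derivative_leading_term[OF U F_eq F A_jacobian f_bigo T H sums IJ]) auto
    ultimately show ?thesis by (rule LIM_unique[symmetric])
  qed
  then obtain \<mu>s \<nu>s where len: "length \<mu>s = p" "length \<nu>s = k + q"
    and eig: "\<And>z. z \<in> set \<mu>s \<union> set \<nu>s \<Longrightarrow> det (mat z - A) = 0"
    and eq: "sum_list \<nu>s = sum_list \<mu>s"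
    using homogeneous_invariant_tensor_eigenvalues[of p q k "H k" A I0 J0 x0] H nz by blast
  obtain I where I: "map ev I = \<mu>s"
    using exists_map_eq[of \<mu>s ev] eig eigenvalue_family_complete[OF ev] by blast
  obtain L where L: "map ev L = \<nu>s"
    using exists_map_eq[of \<nu>s ev] eig eigenvalue_family_complete[OF ev] by blast
  \<comment> \<open>The first \<open>k\<close> indices are those of the differentiations; counting them gives \<open>\<kappa>\<close>.\<close>
  define K J where "K = take k L" "J = drop k L"
  have "length I = p" "length L = k + q" using len I L by auto
  moreover have "(\<Sum>j\<leftarrow>K. ev j) + (\<Sum>j\<leftarrow>J. ev j) = (\<Sum>i\<leftarrow>I. ev i)"
    using eq unfolding K_J_def I[symmetric] L[symmetric]
    by (metis append_take_drop_id map_append sum_list_append)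
  ultimately show ?thesis
    by (intro exI[of _ I] exI[of _ J] exI[of _ "count_list K"])
       (auto simp: sum_count_list sum_count_list_length K_J_def eq_diff_eq)
qed

end
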